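(* Let $I(\boldsymbol{B},\boldsymbol{r})$ be a diagonal blockwise determinantal ideal with $\boldsymbol{B}=(B_1,\dots,B_k)$ and $\boldsymbol{r}=(r_1,\dots,r_k)$, let $\mathcal{G}_i$ be the set of all $r_i$-minors in $B_i$ for $i=1,\dots,k$, and let $<$ be a lexicographic diagonal term order induced by a scanning variable order. If $B_i\cap B_j=\emptyset$ for all $i\ne j$, then $\bigcup_{i=1}^k\mathcal{G}_i$ is a Gröbner basis of $I(\boldsymbol{B},\boldsymbol{r})$ with respect to $<$.
   Context: Let $K$ be a field and $X=(x_{ij})$ a generic $m\times n$ matrix ($m\le n$) of distinct variables; $K[\boldsymbol{x}]$ is the polynomial ring in all $mn$ variables. A subset of $X$ means a set of entries. An $r$-minor of $X$ is the determinant of an $r\times r$ submatrix (arbitrary row and column index sets of size $r$); it is a minor in a subset $B$ if all entries of the submatrix belong to $B$. A non-empty subset $B$ of $X$ is diagonal if whenever $x_{pq},x_{\tilde p\tilde q}\in B$ with $p\le\tilde p$, $q\le\tilde q$, all $x_{ij}$ with $p\le i\le\tilde p$, $q\le j\le\tilde q$ belong to $B$. For a sequence $\boldsymbol{B}=(B_1,\dots,B_k)$ of non-empty subsets of $X$ (blocks) and a sequence $\boldsymbol{r}=(r_1,\dots,r_k)$ of positive integers, the blockwise determinantal ideal $I(\boldsymbol{B},\boldsymbol{r})\subseteq K[\boldsymbol{x}]$ is generated by all $r_i$-minors in $B_i$ for all $i$; it is diagonal when all blocks are diagonal. The scanning variable orders inducing lexicographic diagonal term orders are the four orders in which either the northwest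 corner $x_{11}$ is the greatest variable and the next greatest variables are determined by scanning row by row to the east (rows top to bottom) or column by column to the south (columns left to right), or the southeast corner $x_{mn}$ is the greatest and one scans row by row to the west (rows bottom to top) or column by column to the north (columns right to left). For such a term order the leading term of every minor is the product of its diagonal entries. It is a known fact, taken as given, that for each $i$ the set $\mathcal{G}_i$ is a Gröbner basis of the ideal it generates with respect to such an order. *)

theory Defs
  imports
    "HOL-Library.Cardinality"
    "HOL-Library.Poly_Mapping"
    "Jordan_Normal_Form.Determinant"
begin

text \<open>
  The rows and columns of the generic matrix are indexed by finite linearly ordered types
  \<open>'m\<close> and \<open>'n\<close>, so the polynomial ring in its \<open>mn\<close> entries is a genuine type. The position
  \<open>(i, j)\<close> stands for the variable \<open>x\<^sub>i\<^sub>j\<close>, and a set of entries is a set of positions.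
\<close>

type_synonym ('m, 'n) monom = "('m \<times> 'n) \<Rightarrow>\<^sub>0 nat"
type_synonym ('m, 'n, 'k) mpoly = "('m, 'n) monom \<Rightarrow>\<^sub>0 'k"

definition ideal_gen :: "'a::comm_ring_1 set \<Rightarrow> 'a set" where
  "ideal_gen = Modules.module.span (*)"

subsection \<open>Minors and blocks\<close>

definition entry :: "'m \<times> 'n \<Rightarrow> ('m, 'n, 'k::field) mpoly" where
  "entry v = Poly_Mapping.single (Poly_Mapping.single v 1) 1"

definition minor_poly ::
  "'m::{finite,linorder} set \<Rightarrow> 'n::{finite,linorder} set \<Rightarrow> ('m, 'n, 'k::field) mpoly" where
  "minor_poly I J = det (mat (card I) (card J)
     (\<lambda>(a, b). entry (sorted_list_of_set I ! a, sorted_list_of_set J ! b)))"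

definition minors_in ::
  "nat \<Rightarrow> ('m::{finite,linorder} \<times> 'n::{finite,linorder}) set \<Rightarrow> ('m, 'n, 'k::field) mpoly set" where
  "minors_in r B = {minor_poly I J | I J. card I = r \<and> card J = r \<and> I \<times> J \<subseteq> B}"

definition diagonal_block :: "('m::linorder \<times> 'n::linorder) set \<Rightarrow> bool" where
  "diagonal_block B \<longleftrightarrow> B \<noteq> {} \<and>
     (\<forall>p q p' q'. (p, q) \<in> B \<longrightarrow> (p', q') \<in> B \<longrightarrow> p \<le> p' \<longrightarrow> q \<le> q' \<longrightarrow> {p..p'} \<times> {q..q'} \<subseteq> B)"

text \<open>The blocks are \<open>B 1, \<dots>, B k\<close>, with minor sizes \<open>r 1, \<dots>, r k\<close>.\<close>

definition blockwise_det_ideal ::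
  "nat \<Rightarrow> (nat \<Rightarrow> ('m::{finite,linorder} \<times> 'n::{finite,linorder}) set) \<Rightarrow> (nat \<Rightarrow> nat)
     \<Rightarrow> ('m, 'n, 'k::field) mpoly set" where
  "blockwise_det_ideal k B r = ideal_gen (\<Union>i\<in>{1..k}. minors_in (r i) (B i))"

subsection \<open>Scanning variable orders and lexicographic term orders\<close>

text \<open>
  A variable order is given by its strict ``greater'' relation. The suffix of each scanning
  order names the starting corner (NW or SE) and whether one scans row by row or column by column.
\<close>

definition gt_NW_rows :: "'m::linorder \<times> 'n::linorder \<Rightarrow> 'm \<times> 'n \<Rightarrow> bool" where
  "gt_NW_rows = (\<lambda>(i, j) (p, q). i < p \<or> i = p \<and> j < q)"

definition gt_NW_cols :: "'m::linorder \<times> 'n::linorder \<Rightarrow> 'm \<times> 'n \<Rightarrow> bool" where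
  "gt_NW_cols = (\<lambda>(i, j) (p, q). j < q \<or> j = q \<and> i < p)"

definition gt_SE_rows :: "'m::linorder \<times> 'n::linorder \<Rightarrow> 'm \<times> 'n \<Rightarrow> bool" where
  "gt_SE_rows = (\<lambda>(i, j) (p, q). i > p \<or> i = p \<and> j > q)"

definition gt_SE_cols :: "'m::linorder \<times> 'n::linorder \<Rightarrow> 'm \<times> 'n \<Rightarrow> bool" where
  "gt_SE_cols = (\<lambda>(i, j) (p, q). j > q \<or> j = q \<and> i > p)"

definition scanning_order :: "('m::linorder \<times> 'n::linorder \<Rightarrow> 'm \<times> 'n \<Rightarrow> bool) \<Rightarrow> bool" where
  "scanning_order gt \<longleftrightarrow> gt \<in> {gt_NW_rows, gt_NW_cols, gt_SE_rows, gt_SE_cols}"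

definition lex_less :: "('v \<Rightarrow> 'v \<Rightarrow> bool) \<Rightarrow> ('v \<Rightarrow>\<^sub>0 nat) \<Rightarrow> ('v \<Rightarrow>\<^sub>0 nat) \<Rightarrow> bool" where
  "lex_less gt s t \<longleftrightarrow> (\<exists>v. Poly_Mapping.lookup s v < Poly_Mapping.lookup t v \<and>
     (\<forall>w. gt w v \<longrightarrow> Poly_Mapping.lookup s w = Poly_Mapping.lookup t w))"

subsection \<open>Groebner bases\<close>

definition lead_monom ::
  "(('v \<Rightarrow>\<^sub>0 nat) \<Rightarrow> ('v \<Rightarrow>\<^sub>0 nat) \<Rightarrow> bool) \<Rightarrow> (('v \<Rightarrow>\<^sub>0 nat) \<Rightarrow>\<^sub>0 'k::field) \<Rightarrow> ('v \<Rightarrow>\<^sub>0 nat)" where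
  "lead_monom lt p = (THE t. t \<in> Poly_Mapping.keys p \<and>
     (\<forall>s\<in>Poly_Mapping.keys p. s \<noteq> t \<longrightarrow> lt s t))"

text \<open>
  The leading term includes the coefficient. For \<open>p = 0\<close> the monomial is unspecified, but the
  coefficient, and hence the leading term, is \<open>0\<close>.
\<close>

definition lead_term ::
  "(('v \<Rightarrow>\<^sub>0 nat) \<Rightarrow> ('v \<Rightarrow>\<^sub>0 nat) \<Rightarrow> bool) \<Rightarrow> (('v \<Rightarrow>\<^sub>0 nat) \<Rightarrow>\<^sub>0 'k::field) \<Rightarrow> (('v \<Rightarrow>\<^sub>0 nat) \<Rightarrow>\<^sub>0 'k)" where
  "lead_term lt p = Poly_Mapping.single (lead_monom lt p) (Poly_Mapping.lookup p (lead_monom lt p))"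

definition is_Groebner_basis ::
  "(('v \<Rightarrow>\<^sub>0 nat) \<Rightarrow> ('v \<Rightarrow>\<^sub>0 nat) \<Rightarrow> bool) \<Rightarrow> (('v \<Rightarrow>\<^sub>0 nat) \<Rightarrow>\<^sub>0 'k::field) set
     \<Rightarrow> (('v \<Rightarrow>\<^sub>0 nat) \<Rightarrow>\<^sub>0 'k) set \<Rightarrow> bool" where
  "is_Groebner_basis lt G I \<longleftrightarrow> finite G \<and> G \<subseteq> I \<and>
     ideal_gen (lead_term lt ` G) = ideal_gen (lead_term lt ` I)"

end

theory Submission
  imports Defs
begin

text \<open>
  An \<open>r\<close>-minor in a block \<open>B\<close> is a polynomial in the variables of \<open>B\<close>
  (\<open>minors_in_subset_polys_in\<close>), so disjoint blocks give sets of generators in disjoint sets of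
  variables. The result is thus an instance of a general principle: if
  \<open>G\<close> and \<open>H\<close> are Groebner bases of the ideals that they generate and involve disjoint sets of
  variables, then \<open>G \<union> H\<close> is a Groebner basis (\<open>Groebner_basis_Un_disjoint\<close>). The usual argument
  is that the S-polynomial of two polynomials with coprime leading monomials reduces to zero. The
  proof given here avoids S-polynomials and uses the linear algebra of standard monomials.

  Call a monomial reducible for \<open>G\<close> if it is a multiple of a leading monomial of \<open>G\<close>, and call a
  polynomial standard if none of its monomials is reducible. The division algorithm
  (\<open>division\<close>) shows that every polynomial is the sum of a member of the ideal of \<open>G\<close> and a standard
  polynomial, and \<open>G\<close> is a Groebner basis of its ideal exactly if this sum is direct
  (\<open>Groebner_basis_iff_standard\<close>).

  Now let \<open>f\<close> lie in the ideal of \<open>G \<union> H\<close> and be standard for \<open>G \<union> H\<close>, and write \<open>f = x + y\<close> with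
  \<open>x\<close> in the ideal of \<open>G\<close> and \<open>y = \<Sum> c\<^sub>h h\<close> in the ideal of \<open>H\<close>. Divide the coefficients \<open>c\<^sub>h\<close>, and
  not \<open>y\<close> itself, by \<open>G\<close>. Multiplication by \<open>h\<close> keeps the remainders standard for \<open>G\<close>, because \<open>h\<close>
  involves none of the variables of the leading monomials of \<open>G\<close>
  (\<open>standard_mult_disjoint\<close>). Hence \<open>y = a + s\<close>, where \<open>a\<close> lies in the ideal of \<open>G\<close> and \<open>s\<close> is
  standard for \<open>G\<close> and still in the ideal of \<open>H\<close> (\<open>division_disjoint\<close>). Then \<open>f - s = x + a\<close> is standard
  and in the ideal of \<open>G\<close>, so \<open>f = s\<close>. Thus \<open>f\<close> is standard for \<open>H\<close> and in the ideal of \<open>H\<close>, so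
  \<open>f = 0\<close>. Any finite number of blocks follows by induction.

  Division terminates because the lexicographic order is a well-order on the
  monomials in finitely many variables (\<open>lex_monomial_order\<close>).
\<close>

section \<open>Ideals\<close>

interpretation ideal: Modules.module "(*) :: 'a::comm_ring_1 \<Rightarrow> 'a \<Rightarrow> 'a"
  rewrites "Modules.module.span (*) = (ideal_gen :: 'a set \<Rightarrow> 'a set)"
  by unfold_locales (simp_all add: algebra_simps ideal_gen_def)

section \<open>Monomial orders and division\<close>

text \<open>
  Transitivity is not among the axioms, since a total well-founded relation is transitive: a
  violation would be a cycle of length at most three.
\<close>

locale monomial_order =
  fixes lt :: "('v \<Rightarrow>\<^sub>0 nat) \<Rightarrow> ('v \<Rightarrow>\<^sub>0 nat) \<Rightarrow> bool"
  assumes wf: "wfP lt"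
    and total: "s \<noteq> t \<Longrightarrow> lt s t \<or> lt t s"
    and add_left: "lt s t \<Longrightarrow> lt (u + s) (u + t)"
begin

lemma asym: "lt s t \<Longrightarrow> \<not> lt t s"
  using wfp_imp_asymp[OF wf] by (auto dest: asympD)

lemma trans: assumes "lt s t" "lt t u" shows "lt s u"
proof (rule ccontr)
  assume "\<not> lt s u"
  then have "s = u \<or> lt u s" using total by blast
  \<comment> \<open>A minimal element of a cycle contradicts the fact that each of its elements has a predecessor.\<close>
  moreover obtain x where "x \<in> {s, t, u}" "\<And>y. lt y x \<Longrightarrow> y \<notin> {s, t, u}"
    using wfp_eq_minimal[of lt] wf by (metis insertI1)
  ultimately show False using assms asym by blast
qed

definition below :: "('v \<Rightarrow>\<^sub>0 nat) \<Rightarrow> (('v \<Rightarrow>\<^sub>0 nat) \<Rightarrow>\<^sub>0 'k::field) \<Rightarrow> bool" where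
  "below t p \<longleftrightarrow> (\<forall>s\<in>Poly_Mapping.keys p. lt s t)"

lemma below_diff: "below t p \<Longrightarrow> below t q \<Longrightarrow> below t (p - q)"
  using keys_diff[of p q] by (auto simp: below_def)

lemma below_add: "below t p \<Longrightarrow> below t q \<Longrightarrow> below t (p + q)"
  using Poly_Mapping.keys_add[of p q] by (auto simp: below_def)

lemma below_trans: "below s p \<Longrightarrow> lt s t \<Longrightarrow> below t p"
  using trans by (auto simp: below_def)

lemma below_single: "lt s t \<Longrightarrow> below t (Poly_Mapping.single s c)"
  by (simp add: below_def)

lemma below_times: "below t p \<Longrightarrow> below (u + t) (Poly_Mapping.single u c * p)"
  using keys_mult[of "Poly_Mapping.single u c" p] add_left
  by (fastforce simp: below_def split: if_splits)

lemma not_below_keys: "below t p \<Longrightarrow> t \<notin> Poly_Mapping.keys p"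
  using asym by (auto simp: below_def)

lemma lead_monom:
  assumes "p \<noteq> 0"
  shows lead_monom_in_keys: "lead_monom lt p \<in> Poly_Mapping.keys p"
    and lead_monom_greatest: "s \<in> Poly_Mapping.keys p \<Longrightarrow> s \<noteq> lead_monom lt p \<Longrightarrow> lt s (lead_monom lt p)"
proof -
  have "\<exists>t\<in>Poly_Mapping.keys p. \<forall>s\<in>Poly_Mapping.keys p. s \<noteq> t \<longrightarrow> lt s t"
    using assms trans total by (intro Finite_Set.bex_greatest_element transp_onI totalp_onI) auto
  then obtain t where
    t: "t \<in> Poly_Mapping.keys p" "\<forall>s\<in>Poly_Mapping.keys p. s \<noteq> t \<longrightarrow> lt s t" by blast
  have "\<exists>!t. t \<in> Poly_Mapping.keys p \<and> (\<forall>s\<in>Poly_Mapping.keys p. s \<noteq> t \<longrightarrow> lt s t)"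
  proof (rule ex1I[of _ t])
    fix t' assume t': "t' \<in> Poly_Mapping.keys p \<and> (\<forall>s\<in>Poly_Mapping.keys p. s \<noteq> t' \<longrightarrow> lt s t')"
    show "t' = t"
    proof (rule ccontr)
      assume "t' \<noteq> t"
      then have "lt t t'" "lt t' t" using t t' by auto
      then show False using asym by blast
    qed
  qed (use t in blast)
  from theI'[OF this]
  show "lead_monom lt p \<in> Poly_Mapping.keys p"
    and "s \<in> Poly_Mapping.keys p \<Longrightarrow> s \<noteq> lead_monom lt p \<Longrightarrow> lt s (lead_monom lt p)"
    unfolding lead_monom_def by blast+
qed

lemma lead_term_0 [simp]: "lead_term lt 0 = 0"
  by (simp add: lead_term_def)

lemma below_tail: "below (lead_monom lt p) (p - lead_term lt p)"
proof (cases "p = 0")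
  case False
  show ?thesis unfolding below_def
  proof
    fix s assume s: "s \<in> Poly_Mapping.keys (p - lead_term lt p)"
    then have "s \<noteq> lead_monom lt p"
      by (auto simp: lead_term_def in_keys_iff lookup_minus)
    moreover from this s have "s \<in> Poly_Mapping.keys p"
      by (auto simp: lead_term_def in_keys_iff lookup_minus lookup_single)
    ultimately show "lt s (lead_monom lt p)" using False lead_monom_greatest by blast
  qed
qed (simp add: below_def)

definition reducible :: "(('v \<Rightarrow>\<^sub>0 nat) \<Rightarrow>\<^sub>0 'k::field) set \<Rightarrow> ('v \<Rightarrow>\<^sub>0 nat) set" where
  "reducible G = {lead_monom lt g + u | g u. g \<in> G \<and> g \<noteq> 0}"

definition standard :: "(('v \<Rightarrow>\<^sub>0 nat) \<Rightarrow>\<^sub>0 'k::field) set \<Rightarrow> (('v \<Rightarrow>\<^sub>0 nat) \<Rightarrow>\<^sub>0 'k) set" where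
  "standard G = {p. Poly_Mapping.keys p \<inter> reducible G = {}}"

lemma standard_0: "0 \<in> standard G"
  by (simp add: standard_def)

lemma standard_add: "p \<in> standard G \<Longrightarrow> q \<in> standard G \<Longrightarrow> p + q \<in> standard G"
  using Poly_Mapping.keys_add[of p q] by (auto simp: standard_def)

lemma standard_diff: "p \<in> standard G \<Longrightarrow> q \<in> standard G \<Longrightarrow> p - q \<in> standard G"
  using keys_diff[of p q] by (auto simp: standard_def)

lemma standard_single: "t \<notin> reducible G \<Longrightarrow> Poly_Mapping.single t c \<in> standard G"
  by (simp add: standard_def)

text \<open>
  This is the division algorithm. Either the leading term of \<open>p\<close> is cancelled by a multiple of
  some \<open>g \<in> G\<close>, or it is moved to the remainder; the polynomial that is left has only smaller
  monomials. The bound on the monomials of the remainder \<open>s\<close> makes it possible to divide the tail of a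
  polynomial without disturbing its leading term.
\<close>

lemma division:
  "\<exists>a\<in>ideal_gen G. \<exists>s\<in>standard G. p = a + s \<and> (\<forall>t. below t p \<longrightarrow> below t s)"
proof (cases "p = 0")
  case True
  then show ?thesis using standard_0 ideal.span_zero by force
next
  case False
  then show ?thesis
  proof (induction "lead_monom lt p" arbitrary: p rule: wfp_induct_rule[OF wf])
    case 1
    define m where "m = lead_monom lt p"
    define c where "c = Poly_Mapping.lookup p m"
    define p' where "p' = p - lead_term lt p"
    have p: "p = Poly_Mapping.single m c + p'"
      by (simp add: p'_def lead_term_def m_def c_def)
    have p': "below m p'" using below_tail by (simp add: m_def p'_def)
    have IH: "\<exists>a\<in>ideal_gen G. \<exists>s\<in>standard G. q = a + s \<and> below m s" if "below m q" for q
    proof (cases "q = 0")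
      case True
      then show ?thesis using standard_0 ideal.span_zero by (force simp: below_def)
    next
      case False
      with that have "lt (lead_monom lt q) m" using lead_monom_in_keys by (auto simp: below_def)
      with False that "1.hyps" show ?thesis unfolding m_def by blast
    qed
    have mt: "lt m t" if "below t p" for t
      using that lead_monom_in_keys[OF \<open>p \<noteq> 0\<close>] by (simp add: below_def m_def)
    show ?case
    proof (cases "m \<in> reducible G")
      case True
      then obtain g u where g: "g \<in> G" "g \<noteq> 0" and m: "m = lead_monom lt g + u"
        by (auto simp: reducible_def)
      define b where "b = Poly_Mapping.lookup g (lead_monom lt g)"
      define h where "h = Poly_Mapping.single u (c / b)"
      have "b \<noteq> 0" using lead_monom_in_keys[OF g(2)] by (simp add: b_def in_keys_iff)
      then have "h * lead_term lt g = Poly_Mapping.single m c"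
        by (simp add: h_def lead_term_def mult_single m b_def[symmetric] add.commute)
      \<comment> \<open>The multiplier is chosen so that \<open>h * g\<close> has the leading term of \<open>p\<close>; only tails remain.\<close>
      then have eq: "p = h * g + (p' - h * (g - lead_term lt g))"
        by (simp add: p algebra_simps)
      have "below m (p' - h * (g - lead_term lt g))"
        using below_diff[OF p', of "h * (g - lead_term lt g)"]
          below_times[OF below_tail[of g], of u "c / b"]
        by (simp add: m h_def add.commute)
      from IH[OF this] obtain a s where
        as: "a \<in> ideal_gen G" "s \<in> standard G" "below m s" "p' - h * (g - lead_term lt g) = a + s"
        by blast
      have "h * g + a \<in> ideal_gen G"
        using g(1) by (intro ideal.span_add[OF ideal.span_scale as(1)] ideal.span_base)
      moreover have "p = (h * g + a) + s" using eq as(4) by (simp add: add.assoc)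
      ultimately show ?thesis using as(2) below_trans[OF as(3) mt] by blast
    next
      case False
      from IH[OF p'] obtain a s where
        as: "a \<in> ideal_gen G" "s \<in> standard G" "below m s" "p' = a + s"
        by blast
      have "p = a + (Poly_Mapping.single m c + s)" using p as(4) by (simp add: algebra_simps)
      moreover have "below t (Poly_Mapping.single m c + s)" if "below t p" for t
        using as(3) mt[OF that] by (intro below_add below_single below_trans[OF _ mt[OF that]])
      ultimately show ?thesis
        using as standard_add[OF standard_single[OF False]] by blast
    qed
  qed
qed

lemma single_in_lead_term_ideal:
  "t \<in> reducible G \<Longrightarrow> Poly_Mapping.single t c \<in> ideal_gen (lead_term lt ` G)"
proof -
  assume "t \<in> reducible G"
  then obtain g u where g: "g \<in> G" "g \<noteq> 0" and t: "t = lead_monom lt g + u"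
    by (auto simp: reducible_def)
  define b where "b = Poly_Mapping.lookup g (lead_monom lt g)"
  have "b \<noteq> 0" using lead_monom_in_keys[OF g(2)] by (simp add: b_def in_keys_iff)
  then have "Poly_Mapping.single t c = Poly_Mapping.single u (c / b) * lead_term lt g"
    by (simp add: lead_term_def mult_single t b_def[symmetric] add.commute)
  then show ?thesis using g by (auto intro: ideal.span_scale ideal.span_base)
qed

text \<open>
  The polynomials with only reducible monomials form an ideal, and it contains the leading terms of
  \<open>G\<close>. Together with the previous lemma this turns membership in an ideal of leading terms into
  divisibility of monomials.
\<close>

lemma keys_lead_term_ideal:
  assumes "p \<in> ideal_gen (lead_term lt ` G)" shows "Poly_Mapping.keys p \<subseteq> reducible G"
  using assms
proof (induction rule: ideal.span_induct_alt)
  case (step c x y)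
  then obtain g where g: "g \<in> G" and x: "x = lead_term lt g" by blast
  have "Poly_Mapping.keys (c * x) \<subseteq> reducible G"
  proof (cases "g = 0")
    case False
    have "Poly_Mapping.keys (c * x) \<subseteq> {a + lead_monom lt g | a. True}"
      using keys_mult[of c x] by (auto simp: x lead_term_def split: if_splits)
    also have "\<dots> \<subseteq> reducible G"
      using g False by (auto simp: reducible_def add.commute)
    finally show ?thesis .
  qed (simp add: x)
  then show ?case using step Poly_Mapping.keys_add[of "c * x" y] by blast
qed simp

lemma Groebner_basis_iff_reducible:
  "is_Groebner_basis lt G I \<longleftrightarrow>
     finite G \<and> G \<subseteq> I \<and> (\<forall>f\<in>I. f \<noteq> 0 \<longrightarrow> lead_monom lt f \<in> reducible G)"
proof -
  have "lead_monom lt f \<in> reducible G"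
    if "ideal_gen (lead_term lt ` G) = ideal_gen (lead_term lt ` I)" "f \<in> I" "f \<noteq> 0" for f
  proof -
    have "lead_term lt f \<in> ideal_gen (lead_term lt ` G)"
      using that by (auto intro: ideal.span_base)
    then have "Poly_Mapping.keys (lead_term lt f) \<subseteq> reducible G" by (rule keys_lead_term_ideal)
    with lead_monom_in_keys[OF that(3)] show ?thesis
      by (simp add: lead_term_def in_keys_iff)
  qed
  moreover have "ideal_gen (lead_term lt ` G) = ideal_gen (lead_term lt ` I)"
    if "G \<subseteq> I" "\<forall>f\<in>I. f \<noteq> 0 \<longrightarrow> lead_monom lt f \<in> reducible G"
  proof
    show "ideal_gen (lead_term lt ` G) \<subseteq> ideal_gen (lead_term lt ` I)"
      using that(1) by (intro ideal.span_mono image_mono)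
    have "lead_term lt f \<in> ideal_gen (lead_term lt ` G)" if "f \<in> I" for f
    proof (cases "f = 0")
      case False
      with that \<open>\<forall>f\<in>I. _\<close> have "lead_monom lt f \<in> reducible G" by blast
      then show ?thesis using single_in_lead_term_ideal unfolding lead_term_def[of _ f] by blast
    qed (simp add: ideal.span_zero)
    then show "ideal_gen (lead_term lt ` I) \<subseteq> ideal_gen (lead_term lt ` G)"
      by (intro ideal.span_minimal ideal.subspace_span) auto
  qed
  ultimately show ?thesis unfolding is_Groebner_basis_def by blast
qed

text \<open>
  By \<open>division\<close> the ideal and the standard polynomials always span the whole ring, so the
  condition says that the sum is direct. If it is direct, a polynomial \<open>f\<close> in the ideal cannot have a
  standard leading monomial: reducing only its tail would give a nonzero standard polynomial in the
  ideal, with the same leading term.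
\<close>

lemma Groebner_basis_iff_standard:
  assumes "finite G"
  shows "is_Groebner_basis lt G (ideal_gen G) \<longleftrightarrow> ideal_gen G \<inter> standard G = {0}"
proof
  assume gb: "is_Groebner_basis lt G (ideal_gen G)"
  have "f = 0" if f: "f \<in> ideal_gen G" "f \<in> standard G" for f
  proof (rule ccontr)
    assume "f \<noteq> 0"
    then have "lead_monom lt f \<in> reducible G"
      using gb f(1) unfolding Groebner_basis_iff_reducible by blast
    with f(2) lead_monom_in_keys[OF \<open>f \<noteq> 0\<close>] show False by (auto simp: standard_def)
  qed
  then show "ideal_gen G \<inter> standard G = {0}" using standard_0 ideal.span_zero by blast
next
  assume direct: "ideal_gen G \<inter> standard G = {0}"
  have "lead_monom lt f \<in> reducible G" if f: "f \<in> ideal_gen G" "f \<noteq> 0" for f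
  proof (rule ccontr)
    assume red: "lead_monom lt f \<notin> reducible G"
    obtain a s where as: "a \<in> ideal_gen G" "s \<in> standard G" "f - lead_term lt f = a + s"
      "below (lead_monom lt f) s"
      using division[of G "f - lead_term lt f"] below_tail by blast
    have eq: "f - a = lead_term lt f + s" using as(3) by (simp add: algebra_simps)
    have "lead_term lt f + s \<in> standard G"
      unfolding lead_term_def using standard_single[OF red] as(2) by (rule standard_add)
    moreover have "f - a \<in> ideal_gen G" using f(1) as(1) by (rule ideal.span_diff)
    ultimately have zero: "lead_term lt f + s = 0" using direct eq by auto
    have "Poly_Mapping.lookup s (lead_monom lt f) = 0"
      using not_below_keys[OF as(4)] by (simp add: in_keys_iff)
    then have "Poly_Mapping.lookup (lead_term lt f + s) (lead_monom lt f) \<noteq> 0"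
      using lead_monom_in_keys[OF f(2)] by (simp add: lead_term_def lookup_add in_keys_iff)
    with zero show False by simp
  qed
  then show "is_Groebner_basis lt G (ideal_gen G)"
    using assms ideal.span_superset by (auto simp: Groebner_basis_iff_reducible)
qed

end

section \<open>Generators in disjoint sets of variables\<close>

definition polys_in :: "'v set \<Rightarrow> (('v \<Rightarrow>\<^sub>0 nat) \<Rightarrow>\<^sub>0 'k::field) set" where
  "polys_in V = {p. \<forall>t\<in>Poly_Mapping.keys p. Poly_Mapping.keys t \<subseteq> V}"

lemma polys_in_0 [simp]: "0 \<in> polys_in V"
  by (simp add: polys_in_def)

lemma polys_in_1 [simp]: "1 \<in> polys_in V"
  by (simp add: polys_in_def)

lemma polys_in_add: "p \<in> polys_in V \<Longrightarrow> q \<in> polys_in V \<Longrightarrow> p + q \<in> polys_in V"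
  using Poly_Mapping.keys_add[of p q] by (auto simp: polys_in_def)

lemma polys_in_uminus: "p \<in> polys_in V \<Longrightarrow> - p \<in> polys_in V"
  by (simp add: polys_in_def)

lemma polys_in_mult:
  assumes "p \<in> polys_in V" "q \<in> polys_in V" shows "p * q \<in> polys_in V"
proof -
  have "Poly_Mapping.keys t \<subseteq> V" if t: "t \<in> Poly_Mapping.keys (p * q)" for t
  proof -
    obtain a b where "t = a + b" "a \<in> Poly_Mapping.keys p" "b \<in> Poly_Mapping.keys q"
      using t keys_mult[of p q] by blast
    then show ?thesis using assms Poly_Mapping.keys_add[of a b] unfolding polys_in_def by blast
  qed
  then show ?thesis by (simp add: polys_in_def)
qed

lemma polys_in_sum: "(\<And>x. x \<in> A \<Longrightarrow> f x \<in> polys_in V) \<Longrightarrow> sum f A \<in> polys_in V"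
  by (induction A rule: infinite_finite_induct) (auto intro: polys_in_add)

lemma polys_in_prod: "(\<And>x. x \<in> A \<Longrightarrow> f x \<in> polys_in V) \<Longrightarrow> prod f A \<in> polys_in V"
  by (induction A rule: infinite_finite_induct) (auto intro: polys_in_mult)

context monomial_order
begin

text \<open>
  A leading monomial of \<open>G\<close> that divides a product \<open>a b\<close> of monomials, where \<open>b\<close> has none of its
  variables, already divides \<open>a\<close>.
\<close>

lemma standard_mult_disjoint:
  assumes "G \<subseteq> polys_in V" "V \<inter> W = {}" "s \<in> standard G" "p \<in> polys_in W"
  shows "s * p \<in> standard G"
proof -
  have "t \<notin> reducible G" if t: "t \<in> Poly_Mapping.keys (s * p)" for t
  proof
    assume "t \<in> reducible G"
    then obtain g u where g: "g \<in> G" "g \<noteq> 0" "t = lead_monom lt g + u"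
      by (auto simp: reducible_def)
    let ?m = "lead_monom lt g"
    obtain a b where ab: "t = a + b" "a \<in> Poly_Mapping.keys s" "b \<in> Poly_Mapping.keys p"
      using t keys_mult[of s p] by blast
    have m: "Poly_Mapping.keys ?m \<subseteq> V"
      using assms(1) g lead_monom_in_keys by (auto simp: polys_in_def)
    have b: "Poly_Mapping.keys b \<subseteq> W" using assms(4) ab(3) by (auto simp: polys_in_def)
    have "Poly_Mapping.lookup ?m v \<le> Poly_Mapping.lookup a v" for v
    proof (cases "v \<in> V")
      case True
      then have "Poly_Mapping.lookup b v = 0" using b assms(2) by (auto simp: in_keys_iff)
      moreover have "Poly_Mapping.lookup a v + Poly_Mapping.lookup b v
          = Poly_Mapping.lookup ?m v + Poly_Mapping.lookup u v"
        using g(3) ab(1) by (metis lookup_add)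
      ultimately show ?thesis by simp
    next
      case False
      then have "Poly_Mapping.lookup ?m v = 0" using m by (auto simp: in_keys_iff)
      then show ?thesis by simp
    qed
    then have "a = ?m + (a - ?m)"
      by (intro poly_mapping_eqI) (simp add: lookup_add lookup_minus)
    then have "a \<in> reducible G" using g by (auto simp: reducible_def)
    with ab(2) assms(3) show False by (auto simp: standard_def)
  qed
  then show ?thesis by (auto simp: standard_def)
qed

text \<open>
  Here the coefficients of \<open>f\<close> with respect to \<open>H\<close> are divided by \<open>G\<close>, and this is why the
  remainder \<open>s\<close> stays in the ideal of \<open>H\<close>.
\<close>

lemma division_disjoint:
  assumes "G \<subseteq> polys_in V" "V \<inter> W = {}" "H \<subseteq> polys_in W" "f \<in> ideal_gen H"
  shows "\<exists>a\<in>ideal_gen G. \<exists>s\<in>standard G \<inter> ideal_gen H. f = a + s"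
  using assms(4)
proof (induction rule: ideal.span_induct_alt)
  case base
  then show ?case using standard_0 ideal.span_zero by force
next
  case (step c h y)
  then obtain a s where as: "a \<in> ideal_gen G" "s \<in> standard G" "s \<in> ideal_gen H" "y = a + s"
    by blast
  obtain a' s' where as': "a' \<in> ideal_gen G" "s' \<in> standard G" "c = a' + s'"
    using division by blast
  have "c * h + y = (h * a' + a) + (s' * h + s)" using as(4) as'(3) by (simp add: algebra_simps)
  moreover have "h * a' + a \<in> ideal_gen G"
    using as(1) as'(1) by (intro ideal.span_add ideal.span_scale)
  moreover have "s' * h + s \<in> ideal_gen H"
    using step(1) by (intro ideal.span_add[OF ideal.span_scale as(3)] ideal.span_base)
  moreover have "s' * h + s \<in> standard G"
    using as(2) standard_mult_disjoint[OF assms(1,2) as'(2)] step(1) assms(3)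
    by (auto intro: standard_add)
  ultimately show ?case by blast
qed

lemma reducible_Un: "reducible (G \<union> H) = reducible G \<union> reducible H"
  by (auto simp: reducible_def)

lemma Groebner_basis_Un_disjoint:
  assumes "is_Groebner_basis lt G (ideal_gen G)" "is_Groebner_basis lt H (ideal_gen H)"
    and "G \<subseteq> polys_in V" "H \<subseteq> polys_in W" "V \<inter> W = {}"
  shows "is_Groebner_basis lt (G \<union> H) (ideal_gen (G \<union> H))"
proof -
  have fin: "finite G" "finite H" using assms(1,2) by (auto simp: is_Groebner_basis_def)
  have direct: "ideal_gen G \<inter> standard G = {0}" "ideal_gen H \<inter> standard H = {0}"
    using assms(1,2) Groebner_basis_iff_standard fin by auto
  have "f = 0" if f: "f \<in> ideal_gen (G \<union> H)" "f \<in> standard (G \<union> H)" for f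
  proof -
    have std: "f \<in> standard G" "f \<in> standard H"
      using f(2) by (auto simp: standard_def reducible_Un)
    obtain x y where xy: "x \<in> ideal_gen G" "y \<in> ideal_gen H" "f = x + y"
      using f(1) by (auto simp: ideal.span_Un)
    obtain a s where as: "a \<in> ideal_gen G" "s \<in> standard G" "s \<in> ideal_gen H" "y = a + s"
      using division_disjoint[OF assms(3,5,4) xy(2)] by blast
    have "f - s = x + a" using xy(3) as(4) by simp
    then have "f - s \<in> ideal_gen G" using ideal.span_add[OF xy(1) as(1)] by simp
    moreover have "f - s \<in> standard G" using std(1) as(2) by (rule standard_diff)
    ultimately have "f - s = 0" using direct(1) by blast
    then have "f = s" by simp
    then show "f = 0" using std(2) as(3) direct(2) by auto
  qed
  then show ?thesis
    using fin standard_0 ideal.span_zero by (auto simp: Groebner_basis_iff_standard)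
qed

lemma Groebner_basis_empty: "is_Groebner_basis lt {} (ideal_gen {})"
  using Groebner_basis_iff_standard[of "{}"] by (simp add: standard_0)

theorem Groebner_basis_UN_disjoint:
  assumes "finite A"
    and "\<And>i. i \<in> A \<Longrightarrow> is_Groebner_basis lt (G i) (ideal_gen (G i))"
    and "\<And>i. i \<in> A \<Longrightarrow> G i \<subseteq> polys_in (V i)"
    and "\<And>i j. i \<in> A \<Longrightarrow> j \<in> A \<Longrightarrow> i \<noteq> j \<Longrightarrow> V i \<inter> V j = {}"
  shows "is_Groebner_basis lt (\<Union>i\<in>A. G i) (ideal_gen (\<Union>i\<in>A. G i))"
  using assms
proof (induction rule: finite_induct)
  case empty
  then show ?case using Groebner_basis_empty by simp
next
  case (insert m A)
  have "(\<Union>i\<in>A. G i) \<subseteq> polys_in (\<Union>i\<in>A. V i)"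
    using insert.prems(2) by (fastforce simp: polys_in_def)
  moreover have "V m \<inter> (\<Union>i\<in>A. V i) = {}"
    using insert.hyps(2) insert.prems(3) by blast
  moreover have "is_Groebner_basis lt (\<Union>i\<in>A. G i) (ideal_gen (\<Union>i\<in>A. G i))"
    using insert.prems by (intro insert.IH) auto
  ultimately show ?case
    using Groebner_basis_Un_disjoint[of "G m" "\<Union>i\<in>A. G i" "V m" "\<Union>i\<in>A. V i"] insert.prems
    by simp
qed

end

section \<open>Lexicographic orders\<close>

text \<open>
  This is the well-foundedness of the lexicographic order, stated for comparisons that are
  decided at a variable of an upward closed set \<open>U\<close> so that it can be proved by induction on the size of
  \<open>U\<close>. Removing the smallest variable \<open>v\<close> of \<open>U\<close> gives a minimal \<open>s\<close> for the larger variables; among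
  the monomials that agree with \<open>s\<close> on those, one with the least exponent of \<open>v\<close> is minimal for \<open>U\<close>.
\<close>

lemma ex_lex_minimal:
  assumes "finite U" "\<And>v w. v \<in> U \<Longrightarrow> gt w v \<Longrightarrow> w \<in> U" "s0 \<in> Q"
    and irrefl: "\<And>v. \<not> gt v v"
    and trans: "\<And>u v w. gt u v \<Longrightarrow> gt v w \<Longrightarrow> gt u w"
    and total: "\<And>v w. v \<noteq> w \<Longrightarrow> gt v w \<or> gt w v"
  shows "\<exists>s\<in>Q. \<forall>t\<in>Q. \<not> (\<exists>v\<in>U. Poly_Mapping.lookup t v < (Poly_Mapping.lookup s v :: nat) \<and>
     (\<forall>w. gt w v \<longrightarrow> Poly_Mapping.lookup t w = Poly_Mapping.lookup s w))"
  using assms(1-3)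
proof (induction "card U" arbitrary: U)
  case 0
  then show ?case by auto
next
  case (Suc n)
  then have "U \<noteq> {}" by auto
  have "\<exists>v\<in>U. \<forall>w\<in>U. w \<noteq> v \<longrightarrow> gt w v"
    using Suc.prems(1) \<open>U \<noteq> {}\<close> trans total
    by (intro Finite_Set.bex_greatest_element transp_onI totalp_onI) auto
  then obtain v where v: "v \<in> U" "\<forall>w\<in>U. w \<noteq> v \<longrightarrow> gt w v" by blast
  let ?U = "U - {v}"
  have above_v: "gt w v \<longleftrightarrow> w \<in> ?U" for w
    using v irrefl Suc.prems(2) by blast
  have "\<exists>s\<in>Q. \<forall>t\<in>Q. \<not> (\<exists>v\<in>?U. Poly_Mapping.lookup t v < Poly_Mapping.lookup s v \<and>
     (\<forall>w. gt w v \<longrightarrow> Poly_Mapping.lookup t w = Poly_Mapping.lookup s w))"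
  proof (rule Suc.hyps(1))
    show "n = card ?U" using Suc.hyps(2) v(1) Suc.prems(1) by simp
    show "w \<in> ?U" if "u \<in> ?U" "gt w u" for u w
      using that above_v trans by blast
  qed (use Suc.prems in auto)
  then obtain s where s: "s \<in> Q" "\<forall>t\<in>Q. \<not> (\<exists>v\<in>?U. Poly_Mapping.lookup t v < Poly_Mapping.lookup s v \<and>
     (\<forall>w. gt w v \<longrightarrow> Poly_Mapping.lookup t w = Poly_Mapping.lookup s w))" by blast
  define R where "R = {t \<in> Q. \<forall>w\<in>?U. Poly_Mapping.lookup t w = Poly_Mapping.lookup s w}"
  have "s \<in> R" using s(1) by (simp add: R_def)
  then obtain s' where s': "s' \<in> R"
      "\<And>t. t \<in> R \<Longrightarrow> Poly_Mapping.lookup s' v \<le> Poly_Mapping.lookup t v"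
    using ex_has_least_nat[of "\<lambda>t. t \<in> R" s "\<lambda>t. Poly_Mapping.lookup t v"] by blast
  have "\<not> (\<exists>u\<in>U. Poly_Mapping.lookup t u < Poly_Mapping.lookup s' u \<and>
     (\<forall>w. gt w u \<longrightarrow> Poly_Mapping.lookup t w = Poly_Mapping.lookup s' w))" if t: "t \<in> Q" for t
  proof
    assume "\<exists>u\<in>U. Poly_Mapping.lookup t u < Poly_Mapping.lookup s' u \<and>
     (\<forall>w. gt w u \<longrightarrow> Poly_Mapping.lookup t w = Poly_Mapping.lookup s' w)"
    then obtain u where u: "u \<in> U" "Poly_Mapping.lookup t u < Poly_Mapping.lookup s' u"
      "\<And>w. gt w u \<Longrightarrow> Poly_Mapping.lookup t w = Poly_Mapping.lookup s' w" by blast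
    have agree: "Poly_Mapping.lookup s' w = Poly_Mapping.lookup s w" if "w \<in> ?U" for w
      using s'(1) that by (simp add: R_def)
    show False
    proof (cases "u = v")
      case True
      then have "t \<in> R" using t u(3) above_v agree by (simp add: R_def)
      with s'(2) u(2) True show False by (simp add: leD)
    next
      case False
      then have "u \<in> ?U" using u(1) by simp
      moreover have "gt w u \<Longrightarrow> w \<in> ?U" for w using \<open>u \<in> ?U\<close> above_v trans by blast
      ultimately show False using s(2) t u agree by metis
    qed
  qed
  then show ?case using s'(1) by (auto simp: R_def)
qed

lemma lex_monomial_order:
  fixes gt :: "'v::finite \<Rightarrow> 'v \<Rightarrow> bool"
  assumes irrefl: "\<And>v. \<not> gt v v"
    and trans: "\<And>u v w. gt u v \<Longrightarrow> gt v w \<Longrightarrow> gt u w"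
    and total: "\<And>v w. v \<noteq> w \<Longrightarrow> gt v w \<or> gt w v"
  shows "monomial_order (lex_less gt)"
proof
  show "wfP (lex_less gt)"
    unfolding wfp_eq_minimal lex_less_def
  proof (intro allI impI)
    fix Q :: "('v \<Rightarrow>\<^sub>0 nat) set" and s0
    assume "s0 \<in> Q"
    have "\<exists>s\<in>Q. \<forall>t\<in>Q. \<not> (\<exists>v\<in>UNIV. Poly_Mapping.lookup t v < Poly_Mapping.lookup s v \<and>
        (\<forall>w. gt w v \<longrightarrow> Poly_Mapping.lookup t w = Poly_Mapping.lookup s w))"
    proof (rule ex_lex_minimal)
      show "gt u w" if "gt u v" "gt v w" for u v w using that by (rule trans)
      show "gt v w \<or> gt w v" if "v \<noteq> w" for v w using that by (rule total)
    qed (use \<open>s0 \<in> Q\<close> irrefl in auto)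
    then show "\<exists>z\<in>Q. \<forall>y. (\<exists>v. Poly_Mapping.lookup y v < Poly_Mapping.lookup z v \<and>
        (\<forall>w. gt w v \<longrightarrow> Poly_Mapping.lookup y w = Poly_Mapping.lookup z w)) \<longrightarrow> y \<notin> Q"
      by blast
  qed
  \<comment> \<open>Two monomials are compared at the greatest variable at which they differ.\<close>
  show "lex_less gt s t \<or> lex_less gt t s" if "s \<noteq> t" for s t :: "'v \<Rightarrow>\<^sub>0 nat"
  proof -
    define D where "D = {v. Poly_Mapping.lookup s v \<noteq> Poly_Mapping.lookup t v}"
    have "D \<noteq> {}" using that by (auto simp: D_def intro: poly_mapping_eqI)
    have "\<exists>v\<in>D. \<forall>w\<in>D. w \<noteq> v \<longrightarrow> gt v w"
      using \<open>D \<noteq> {}\<close> trans total by (intro Finite_Set.bex_least_element transp_onI totalp_onI) auto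
    then have "\<exists>v\<in>D. \<forall>w\<in>D. \<not> gt w v" using irrefl trans by metis
    then obtain v where v: "v \<in> D" "\<And>w. gt w v \<Longrightarrow> w \<notin> D" by blast
    then show ?thesis
      unfolding lex_less_def D_def by (metis (mono_tags, lifting) mem_Collect_eq nat_neq_iff)
  qed
  show "lex_less gt (u + s) (u + t)" if "lex_less gt s t" for s t u :: "'v \<Rightarrow>\<^sub>0 nat"
    using that by (simp add: lex_less_def lookup_add)
qed

lemma scanning_monomial_order:
  fixes gt :: "'m::{finite,linorder} \<times> 'n::{finite,linorder} \<Rightarrow> 'm \<times> 'n \<Rightarrow> bool"
  assumes "scanning_order gt"
  shows "monomial_order (lex_less gt)"
  using assms unfolding scanning_order_def
  by (intro lex_monomial_order)
    (auto simp: gt_NW_rows_def gt_NW_cols_def gt_SE_rows_def gt_SE_cols_def)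

section \<open>Minors\<close>

lemma minors_in_subset_polys_in:
  fixes B :: "('m::{finite,linorder} \<times> 'n::{finite,linorder}) set"
  shows "(minors_in r B :: ('m, 'n, 'k::field) mpoly set) \<subseteq> polys_in B"
proof
  fix p :: "('m, 'n, 'k) mpoly"
  assume "p \<in> minors_in r B"
  then obtain I J where IJ: "card I = r" "card J = r" "I \<times> J \<subseteq> B" and p: "p = minor_poly I J"
    by (auto simp: minors_in_def)
  have entry: "entry (sorted_list_of_set I ! a, sorted_list_of_set J ! b) \<in> polys_in B"
    if "a < r" "b < r" for a b
  proof -
    have "sorted_list_of_set I ! a \<in> I" "sorted_list_of_set J ! b \<in> J"
      using that IJ nth_mem[of a "sorted_list_of_set I"] nth_mem[of b "sorted_list_of_set J"]
      by auto
    then show ?thesis using IJ(3) by (auto simp: polys_in_def entry_def)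
  qed
  have sign: "signof \<pi> \<in> polys_in B" for \<pi> :: "nat \<Rightarrow> nat"
    by (simp add: sign_def polys_in_uminus)
  show "p \<in> polys_in B"
    unfolding p minor_poly_def det_def IJ
    by (auto intro!: polys_in_sum polys_in_mult polys_in_prod sign entry dest: permutes_in_image)
qed

section \<open>Blockwise determinantal ideals\<close>

theorem corollary3p4:
  fixes B :: "nat \<Rightarrow> ('m::{finite,linorder} \<times> 'n::{finite,linorder}) set"
    and r :: "nat \<Rightarrow> nat" and k :: nat
    and gt :: "'m \<times> 'n \<Rightarrow> 'm \<times> 'n \<Rightarrow> bool"
    and G :: "nat \<Rightarrow> ('m, 'n, 'k::field) mpoly set"
  assumes "CARD('m) \<le> CARD('n)"
    and "\<And>i. i \<in> {1..k} \<Longrightarrow> diagonal_block (B i)"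
    and "\<And>i. i \<in> {1..k} \<Longrightarrow> r i > 0"
    and "\<And>i. i \<in> {1..k} \<Longrightarrow> G i = minors_in (r i) (B i)"
    and "scanning_order gt"
    and "\<And>i. i \<in> {1..k} \<Longrightarrow> is_Groebner_basis (lex_less gt) (G i) (ideal_gen (G i))"
    and "\<And>i j. i \<in> {1..k} \<Longrightarrow> j \<in> {1..k} \<Longrightarrow> i \<noteq> j \<Longrightarrow> B i \<inter> B j = {}"
  shows "is_Groebner_basis (lex_less gt) (\<Union>i\<in>{1..k}. G i) (blockwise_det_ideal k B r)"
proof -
  interpret monomial_order "lex_less gt" using assms(5) by (rule scanning_monomial_order)
  have "is_Groebner_basis (lex_less gt) (\<Union>i\<in>{1..k}. G i) (ideal_gen (\<Union>i\<in>{1..k}. G i))"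
  proof (rule Groebner_basis_UN_disjoint[where V = B])
    show "G i \<subseteq> polys_in (B i)" if "i \<in> {1..k}" for i
      unfolding assms(4)[OF that] by (rule minors_in_subset_polys_in)
  qed (use assms(6,7) in auto)
  moreover have "(\<Union>i\<in>{1..k}. minors_in (r i) (B i)) = (\<Union>i\<in>{1..k}. G i)"
    using assms(4) by simp
  ultimately show ?thesis by (simp add: blockwise_det_ideal_def)
qed

end
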